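(* Let $(E,d)$ be a complete separable metric space and let $\varphi$ be a white noise $E$-valued random dynamical system over $(\Omega,\mathcal F,\mathbb P,\theta)$ whose associated Markov semigroup has an ergodic invariant probability measure $\rho$. Assume that $\varphi$ satisfies weak synchronization. Then $\varphi$ is strongly mixing and, for all $x,y\in E$, $$d(\varphi_t(\cdot,x),\varphi_t(\cdot,y))\to0\quad\text{for }t\to\infty,\text{ in probability.}$$ In particular, $\varphi$ satisfies weak global pointwise stability.
   Context: White noise RDS. $(\Omega,\mathcal F,\mathbb P)$ is a probability space (not necessarily complete), $\theta=(\theta_t)_{t\in\mathbb R}$ is a group of jointly measurable maps on it with ergodic invariant measure $\mathbb P$. The map $\varphi:\mathbb R_+\times\Omega\times E\to E$ is a perfect cocycle: it is measurable, $\varphi_0(\omega,x)=x$ and $\varphi_{t+s}(\omega,x)=\varphi_t(\theta_s\omega,\varphi_s(\omega,x))$ for all $x\in E$, $s,t\ge 0$, $\omega\in\Omega$; and $x\mapsto\varphi_s(\omega,x)$ is continuous for all $s\ge0$, $\omega\in\Omega$. There are sub-$\sigma$-algebras $(\mathcal F_{s,t})_{-\infty<s\le t<\infty}$ of $\mathcal F$ with $\mathcal F_{t,u}\subseteq\mathcal F_{s,v}$ for $s\le t\le u\le v$, $\theta_r^{-1}(\mathcal F_{s,t})=\mathcal F_{s+r,t+r}$ for all $r,s,t$, and $\mathcal F_{t_0,t_1},\dots,\mathcal F_{t_{n-1},t_n}$ independent for all $t_0\le\dots\le t_n$. $\mathcal F_t$ is the $\sigma$-algebra generated by all $\mathcal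 F_{s,t}$, $s\le t$. It is assumed that $\varphi_s(\cdot,x)$ is $\mathcal F_{0,s}$-measurable for each $s\ge0$, $x\in E$. Markov semigroup: $P_tf(x):=\mathbb E f(\varphi_t(\cdot,x))$ for bounded measurable $f$; "invariant probability measure" means invariant for $(P_t)$. $\varphi$ is strongly mixing (with respect to $\rho$) if $P_tf(x)\to\int_E f\,d\rho$ as $t\to\infty$ for each bounded continuous $f$ and all $x\in E$, i.e. the law of $\varphi_t(\cdot,x)$ converges to $\rho$ for all $x\in E$. Weak global pointwise stability: there exist a (measurable) set $U\subseteq E$ with $\rho(U)=1$ and a sequence $t_n\uparrow\infty$ such that for all $x,y\in U$ there is $\delta=\delta(x,y)>0$ such that for all $\eta>0$: $\liminf_{n\to\infty}\mathbb P\big(d(\varphi_{t_n}(\cdot,x),\varphi_{t_n}(\cdot,y))\le\eta\big)\ge\delta(x,y)$. Weak synchronization: there exists an $\mathcal F_0$-measurable $E$-valued random variable $a$ such that (1) for all $t\ge0$, $\varphi_t(\omega,a(\omega))=a(\theta_t\omega)$ almost surely, and (2) for every $x\in E$, $d(\varphi_t(\theta_{-t}\omega,x),a(\omega))\to0$ in probability as $t\to\infty$. *)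

theory Defs
  imports "HOL-Probability.Probability"
begin

locale ergodic_flow = prob_space M for M :: "'w measure" +
  fixes \<theta> :: "real \<Rightarrow> 'w \<Rightarrow> 'w"
  assumes flow_measurable: "(\<lambda>(t, \<omega>). \<theta> t \<omega>) \<in> borel \<Otimes>\<^sub>M M \<rightarrow>\<^sub>M M"
    and flow_zero: "\<And>\<omega>. \<omega> \<in> space M \<Longrightarrow> \<theta> 0 \<omega> = \<omega>"
    and flow_add: "\<And>s t \<omega>. \<omega> \<in> space M \<Longrightarrow> \<theta> (s + t) \<omega> = \<theta> s (\<theta> t \<omega>)"
    and flow_invariant: "\<And>t. distr M M (\<theta> t) = M"
    and flow_ergodic:
      "\<And>A. A \<in> sets M \<Longrightarrow> (\<And>t. \<theta> t -` A \<inter> space M = A) \<Longrightarrow> measure M A = 0 \<or> measure M A = 1"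

text \<open>
  Time runs through \<open>[0, \<infinity>)\<close>: the values of \<open>\<phi>\<close> at negative times, and of \<open>F s t\<close> for
  \<open>t < s\<close>, are unconstrained junk.
\<close>

locale white_noise_rds = ergodic_flow M \<theta> for M :: "'w measure" and \<theta> +
  fixes F :: "real \<Rightarrow> real \<Rightarrow> 'w measure"
    and \<phi> :: "real \<Rightarrow> 'w \<Rightarrow> 'e :: polish_space \<Rightarrow> 'e"
  assumes cocycle_measurable:
      "(\<lambda>(t, \<omega>, x). \<phi> t \<omega> x)
        \<in> restrict_space borel {0..} \<Otimes>\<^sub>M (M \<Otimes>\<^sub>M borel) \<rightarrow>\<^sub>M borel"
    and cocycle_zero: "\<And>\<omega> x. \<omega> \<in> space M \<Longrightarrow> \<phi> 0 \<omega> x = x"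
    and cocycle_add:
      "\<And>s t \<omega> x. 0 \<le> s \<Longrightarrow> 0 \<le> t \<Longrightarrow> \<omega> \<in> space M \<Longrightarrow> \<phi> (t + s) \<omega> x = \<phi> t (\<theta> s \<omega>) (\<phi> s \<omega> x)"
    and cocycle_continuous:
      "\<And>s \<omega>. 0 \<le> s \<Longrightarrow> \<omega> \<in> space M \<Longrightarrow> continuous_on UNIV (\<phi> s \<omega>)"
    and noise_subalgebra: "\<And>s t. s \<le> t \<Longrightarrow> subalgebra M (F s t)"
    and noise_mono:
      "\<And>s t u v. s \<le> t \<Longrightarrow> t \<le> u \<Longrightarrow> u \<le> v \<Longrightarrow> sets (F t u) \<subseteq> sets (F s v)"
    and noise_shift:
      "\<And>r s t. s \<le> t \<Longrightarrow>
        {\<theta> r -` A \<inter> space M |A. A \<in> sets (F s t)} = sets (F (s + r) (t + r))"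
    and noise_indep:
      "\<And>(\<tau> :: nat \<Rightarrow> real) n. (\<And>i. i < n \<Longrightarrow> \<tau> i \<le> \<tau> (Suc i)) \<Longrightarrow>
        indep_sets (\<lambda>i. sets (F (\<tau> i) (\<tau> (Suc i)))) {..<n}"
    and cocycle_adapted: "\<And>s x. 0 \<le> s \<Longrightarrow> (\<lambda>\<omega>. \<phi> s \<omega> x) \<in> F 0 s \<rightarrow>\<^sub>M borel"

definition past :: "'w measure \<Rightarrow> (real \<Rightarrow> real \<Rightarrow> 'w measure) \<Rightarrow> real \<Rightarrow> 'w measure" where
  "past M F t = sigma (space M) (\<Union>s\<in>{..t}. sets (F s t))"

definition markov_op ::
  "'w measure \<Rightarrow> (real \<Rightarrow> 'w \<Rightarrow> 'e \<Rightarrow> 'e) \<Rightarrow> real \<Rightarrow> ('e \<Rightarrow> real) \<Rightarrow> 'e \<Rightarrow> real" where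
  "markov_op M \<phi> t f x = (\<integral>\<omega>. f (\<phi> t \<omega> x) \<partial>M)"

definition invariant_prob ::
  "'w measure \<Rightarrow> (real \<Rightarrow> 'w \<Rightarrow> 'e :: polish_space \<Rightarrow> 'e) \<Rightarrow> 'e measure \<Rightarrow> bool" where
  "invariant_prob M \<phi> \<rho> \<longleftrightarrow> prob_space \<rho> \<and> sets \<rho> = sets borel \<and>
    (\<forall>t\<ge>0. \<forall>f\<in>borel_measurable borel. bounded (range f) \<longrightarrow>
      (\<integral>x. markov_op M \<phi> t f x \<partial>\<rho>) = (\<integral>x. f x \<partial>\<rho>))"

definition ergodic_invariant_prob ::
  "'w measure \<Rightarrow> (real \<Rightarrow> 'w \<Rightarrow> 'e :: polish_space \<Rightarrow> 'e) \<Rightarrow> 'e measure \<Rightarrow> bool" where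
  "ergodic_invariant_prob M \<phi> \<rho> \<longleftrightarrow> invariant_prob M \<phi> \<rho> \<and>
    (\<forall>A\<in>sets borel.
      (\<forall>t\<ge>0. AE x in \<rho>. markov_op M \<phi> t (indicator A) x = indicator A x) \<longrightarrow>
      measure \<rho> A = 0 \<or> measure \<rho> A = 1)"

definition strongly_mixing ::
  "'w measure \<Rightarrow> (real \<Rightarrow> 'w \<Rightarrow> 'e :: polish_space \<Rightarrow> 'e) \<Rightarrow> 'e measure \<Rightarrow> bool" where
  "strongly_mixing M \<phi> \<rho> \<longleftrightarrow>
    (\<forall>f :: 'e \<Rightarrow> real. continuous_on UNIV f \<longrightarrow> bounded (range f) \<longrightarrow>
      (\<forall>x. ((\<lambda>t. markov_op M \<phi> t f x) \<longlongrightarrow> (\<integral>y. f y \<partial>\<rho>)) at_top))"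

definition tendsto_in_prob ::
  "'w measure \<Rightarrow> ('i \<Rightarrow> 'w \<Rightarrow> 'b :: metric_space) \<Rightarrow> ('w \<Rightarrow> 'b) \<Rightarrow> 'i filter \<Rightarrow> bool" where
  "tendsto_in_prob M X Y G \<longleftrightarrow>
    (\<forall>\<epsilon>>0. ((\<lambda>i. measure M {\<omega> \<in> space M. \<epsilon> < dist (X i \<omega>) (Y \<omega>)}) \<longlongrightarrow> 0) G)"

definition weak_synchronization ::
  "'w measure \<Rightarrow> (real \<Rightarrow> 'w \<Rightarrow> 'w) \<Rightarrow> (real \<Rightarrow> real \<Rightarrow> 'w measure) \<Rightarrow>
    (real \<Rightarrow> 'w \<Rightarrow> 'e :: polish_space \<Rightarrow> 'e) \<Rightarrow> bool" where
  "weak_synchronization M \<theta> F \<phi> \<longleftrightarrow>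
    (\<exists>a \<in> past M F 0 \<rightarrow>\<^sub>M borel.
      (\<forall>t\<ge>0. AE \<omega> in M. \<phi> t \<omega> (a \<omega>) = a (\<theta> t \<omega>)) \<and>
      (\<forall>x. tendsto_in_prob M (\<lambda>t \<omega>. dist (\<phi> t (\<theta> (- t) \<omega>) x) (a \<omega>)) (\<lambda>\<omega>. 0) at_top))"

definition weak_global_pointwise_stability ::
  "'w measure \<Rightarrow> (real \<Rightarrow> 'w \<Rightarrow> 'e :: polish_space \<Rightarrow> 'e) \<Rightarrow> 'e measure \<Rightarrow> bool" where
  "weak_global_pointwise_stability M \<phi> \<rho> \<longleftrightarrow>
    (\<exists>U\<in>sets borel. measure \<rho> U = 1 \<and>
      (\<exists>\<tau> :: nat \<Rightarrow> real. (\<forall>n. 0 \<le> \<tau> n) \<and> incseq \<tau> \<and> filterlim \<tau> at_top sequentially \<and>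
        (\<forall>x\<in>U. \<forall>y\<in>U. \<exists>\<delta>>0. \<forall>\<eta>>0.
          ereal \<delta> \<le> liminf (\<lambda>n. ereal (measure M
            {\<omega> \<in> space M. dist (\<phi> (\<tau> n) \<omega> x) (\<phi> (\<tau> n) \<omega> y) \<le> \<eta>})))))"

end

theory Submission
  imports Defs
begin

text \<open>
  Fix \<open>x\<close>. Since \<open>\<theta>\<close> preserves \<open>M\<close>, the variable \<open>\<phi> t \<omega> x\<close> has the same law as its pullback
  \<open>\<phi> t (\<theta> (- t) \<omega>) x\<close>, and weak synchronization says that the pullback converges in probability to
  a variable \<open>a\<close> that does not depend on \<open>x\<close>. Two consequences are drawn.

  Convergence in probability implies convergence in law
  (\<open>tendsto_in_prob_imp_tendsto_expectation\<close>), so \<open>P\<^sub>t f x \<longlonglongrightarrow> E f(a)\<close> for every bounded continuous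
  \<open>f\<close> and every \<open>x\<close>. Integrating against the invariant measure \<open>\<rho>\<close> leaves the left-hand side
  equal to \<open>\<integral> f d\<rho>\<close> for all \<open>t\<close>, and dominated convergence gives \<open>\<integral> f d\<rho> = E f(a)\<close>; hence the
  limit is the one that strong mixing asks for.

  The pair \<open>(\<phi> t \<omega> x, \<phi> t \<omega> y)\<close> also has the law of its pullback, both components of which are
  eventually close to the same point \<open>a\<close> with high probability. The triangle inequality gives the
  convergence of the distance, and with it weak pointwise stability for all pairs of points with
  \<open>\<delta> = 1\<close>.
\<close>

section \<open>Convergence in probability and in law\<close>

text \<open>
  A bounded continuous \<open>f\<close> on a noncompact space need not be uniformly continuous. The sets
  \<open>B k\<close> of points where \<open>f\<close> oscillates by more than \<open>\<epsilon>\<close> within distance \<open>1 / (k + 1)\<close> are open and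
  decrease to the empty set, so the limit \<open>a\<close> avoids one of them with probability close to \<open>1\<close>; off
  that set \<open>f\<close> has a uniform modulus of continuity.
\<close>

lemma (in prob_space) tendsto_in_prob_imp_tendsto_expectation:
  fixes X :: "'i \<Rightarrow> 'a \<Rightarrow> 'e :: {second_countable_topology, metric_space}"
    and f :: "'e \<Rightarrow> real"
  assumes X: "\<forall>\<^sub>F i in G. X i \<in> borel_measurable M"
    and a [measurable]: "a \<in> borel_measurable M"
    and conv: "tendsto_in_prob M (\<lambda>i \<omega>. dist (X i \<omega>) (a \<omega>)) (\<lambda>\<omega>. 0) G"
    and f: "continuous_on UNIV f" "bounded (range f)"
  shows "((\<lambda>i. \<integral>\<omega>. f (X i \<omega>) \<partial>M) \<longlongrightarrow> (\<integral>\<omega>. f (a \<omega>) \<partial>M)) G"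
proof (rule tendstoI)
  fix e :: real assume e: "0 < e"
  obtain C where C: "\<And>x. \<bar>f x\<bar> \<le> C" and C0: "0 < C"
    using f(2) unfolding bounded_pos by auto
  have [measurable]: "f \<in> borel_measurable borel"
    using f(1) by (rule borel_measurable_continuous_onI)
  define \<epsilon> where "\<epsilon> = e / 4"
  define \<eta> where "\<eta> = e / (8 * C)"
  have \<epsilon>: "0 < \<epsilon>" and \<eta>: "0 < \<eta>" using e C0 by (auto simp: \<epsilon>_def \<eta>_def)
  define B where "B k = {z. \<exists>y. dist y z < 1 / real (Suc k) \<and> \<epsilon> < \<bar>f y - f z\<bar>}" for k
  have B_open: "open (B k)" for k
  proof -
    have "open {z. dist y z < 1 / real (Suc k) \<and> \<epsilon> < \<bar>f y - f z\<bar>}" for y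
      using f(1) by (intro open_Collect_conj open_Collect_less continuous_intros)
    moreover have "B k = (\<Union>y. {z. dist y z < 1 / real (Suc k) \<and> \<epsilon> < \<bar>f y - f z\<bar>})"
      by (auto simp: B_def)
    ultimately show ?thesis by auto
  qed
  then have [measurable]: "B k \<in> sets borel" for k by auto
  have B_empty: "(\<Inter>k. B k) = {}"
  proof (rule ccontr)
    assume "(\<Inter>k. B k) \<noteq> {}"
    then obtain z where z: "z \<in> B k" for k by auto
    from f(1) have "isCont f z" by (simp add: continuous_on_eq_continuous_at)
    then obtain d where d: "0 < d" "\<And>y. dist y z < d \<Longrightarrow> dist (f y) (f z) < \<epsilon>"
      using \<epsilon> unfolding continuous_at_eps_delta by blast
    obtain k where k: "1 / real (Suc k) < d"
      using d(1) nat_approx_posE by blast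
    from z[of k] obtain y where "dist y z < 1 / real (Suc k)" "\<epsilon> < \<bar>f y - f z\<bar>"
      by (auto simp: B_def)
    with d(2)[of y] k show False by (simp add: dist_real_def)
  qed
  have "decseq (\<lambda>k. a -` B k \<inter> space M)"
  proof (rule decseq_SucI)
    fix k
    have "1 / real (Suc (Suc k)) \<le> 1 / real (Suc k)" by (intro divide_left_mono) auto
    then have "B (Suc k) \<subseteq> B k"
      unfolding B_def by (intro Collect_mono ex_mono conj_mono) (auto intro: less_le_trans)
    then show "a -` B (Suc k) \<inter> space M \<subseteq> a -` B k \<inter> space M" by auto
  qed
  then have "(\<lambda>k. prob (a -` B k \<inter> space M)) \<longlonglongrightarrow> prob (\<Inter>k. a -` B k \<inter> space M)"
    by (intro finite_Lim_measure_decseq) (auto intro: measurable_sets[OF a])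
  moreover have "(\<Inter>k. a -` B k \<inter> space M) = {}" using B_empty by auto
  ultimately have "(\<lambda>k. prob (a -` B k \<inter> space M)) \<longlonglongrightarrow> 0" by simp
  from order_tendstoD(2)[OF this \<eta>] obtain k where k: "prob (a -` B k \<inter> space M) < \<eta>"
    by (auto simp: eventually_sequentially)
  define r where "r = 1 / (2 * real (Suc k))"
  have r: "0 < r" "r < 1 / real (Suc k)" by (auto simp: r_def field_simps)
  have far: "\<forall>\<^sub>F i in G. prob {\<omega> \<in> space M. r < dist (X i \<omega>) (a \<omega>)} < \<eta>"
    using conv r(1) by (intro order_tendstoD(2)[OF _ \<eta>]) (simp add: tendsto_in_prob_def)
  show "\<forall>\<^sub>F i in G. dist (\<integral>\<omega>. f (X i \<omega>) \<partial>M) (\<integral>\<omega>. f (a \<omega>) \<partial>M) < e"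
    using X far
  proof eventually_elim
    fix i assume [measurable]: "X i \<in> borel_measurable M"
      and i: "prob {\<omega> \<in> space M. r < dist (X i \<omega>) (a \<omega>)} < \<eta>"
    define A where "A = a -` B k \<inter> space M"
    define D where "D = {\<omega> \<in> space M. r < dist (X i \<omega>) (a \<omega>)}"
    have [measurable]: "A \<in> sets M" "D \<in> sets M"
      unfolding A_def D_def by measurable
    have int: "integrable M (\<lambda>\<omega>. f (X i \<omega>))" "integrable M (\<lambda>\<omega>. f (a \<omega>))"
      by (auto intro!: integrable_const_bound[where B = C] simp: C)
    have pt: "\<bar>f (X i \<omega>) - f (a \<omega>)\<bar> \<le> \<epsilon> + 2 * C * (indicator A \<omega> + indicator D \<omega>)"
      if \<omega>: "\<omega> \<in> space M" for \<omega>
    proof (cases "\<omega> \<in> A \<or> \<omega> \<in> D")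
      case True
      then have "1 \<le> (indicator A \<omega> + indicator D \<omega> :: real)"
        by (auto simp: indicator_def)
      then have "2 * C * 1 \<le> 2 * C * (indicator A \<omega> + indicator D \<omega>)"
        using C0 by (intro mult_left_mono) auto
      moreover have "\<bar>f (X i \<omega>) - f (a \<omega>)\<bar> \<le> 2 * C"
        using C[of "X i \<omega>"] C[of "a \<omega>"] by linarith
      ultimately show ?thesis using \<epsilon> by linarith
    next
      case False
      with \<omega> have "dist (X i \<omega>) (a \<omega>) < 1 / real (Suc k)" "a \<omega> \<notin> B k"
        using r(2) by (auto simp: A_def D_def)
      then have "\<bar>f (X i \<omega>) - f (a \<omega>)\<bar> \<le> \<epsilon>" unfolding B_def by force
      with False show ?thesis by simp
    qed
    have "\<bar>(\<integral>\<omega>. f (X i \<omega>) \<partial>M) - (\<integral>\<omega>. f (a \<omega>) \<partial>M)\<bar> = \<bar>\<integral>\<omega>. f (X i \<omega>) - f (a \<omega>) \<partial>M\<bar>"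
      using int by simp
    also have "\<dots> \<le> (\<integral>\<omega>. \<bar>f (X i \<omega>) - f (a \<omega>)\<bar> \<partial>M)" by (rule integral_abs_bound)
    also have "\<dots> \<le> (\<integral>\<omega>. \<epsilon> + 2 * C * (indicator A \<omega> + indicator D \<omega>) \<partial>M)"
      using int pt by (intro integral_mono) (auto simp: emeasure_eq_measure)
    also have "\<dots> = \<epsilon> + 2 * C * (prob A + prob D)"
      by (simp add: emeasure_eq_measure prob_space)
    also have "\<dots> < \<epsilon> + 2 * C * (\<eta> + \<eta>)"
      using k i C0 by (intro add_strict_left_mono mult_strict_left_mono add_strict_mono)
        (auto simp: A_def D_def)
    also have "\<dots> < e" using C0 e by (simp add: \<epsilon>_def \<eta>_def field_simps)
    finally show "dist (\<integral>\<omega>. f (X i \<omega>) \<partial>M) (\<integral>\<omega>. f (a \<omega>) \<partial>M) < e"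
      by (simp add: dist_real_def)
  qed
qed

section \<open>The pullback and the limit law\<close>

context white_noise_rds
begin

lemma measurable_flow [measurable]: "\<theta> t \<in> M \<rightarrow>\<^sub>M M"
  using measurable_compose[OF measurable_Pair1' flow_measurable, of t] by simp

lemma measurable_cocycle_pair:
  assumes "0 \<le> t"
  shows "(\<lambda>(\<omega>, x). \<phi> t \<omega> x) \<in> M \<Otimes>\<^sub>M borel \<rightarrow>\<^sub>M borel"
  using measurable_compose[OF measurable_Pair1' cocycle_measurable, of t] assms
  by (simp add: space_restrict_space case_prod_beta')

lemma measurable_cocycle:
  assumes "0 \<le> t"
  shows "(\<lambda>\<omega>. \<phi> t \<omega> x) \<in> M \<rightarrow>\<^sub>M borel"
  using measurable_compose[OF _ measurable_cocycle_pair[OF assms], of "\<lambda>\<omega>. (\<omega>, x)" M] by simp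

lemma measurable_past_imp_measurable:
  assumes "a \<in> past M F t \<rightarrow>\<^sub>M N"
  shows "a \<in> M \<rightarrow>\<^sub>M N"
proof -
  have sub: "(\<Union>s\<in>{..t}. sets (F s t)) \<subseteq> sets M"
    using noise_subalgebra by (auto simp: subalgebra_def)
  then have pow: "(\<Union>s\<in>{..t}. sets (F s t)) \<subseteq> Pow (space M)"
    using sets.space_closed[of M] by blast
  have "sets (past M F t) \<subseteq> sets M"
    using sets.sigma_sets_subset[OF sub] pow by (simp add: past_def)
  moreover have "space (past M F t) = space M"
    using pow by (simp add: past_def space_measure_of)
  ultimately show ?thesis
    using assms measurable_mono[of N N "past M F t" M] by auto
qed

lemma measure_flow_pullback:
  assumes "Measurable.pred M Q"
  shows "measure M {\<omega> \<in> space M. Q (\<theta> t \<omega>)} = measure M {\<omega> \<in> space M. Q \<omega>}"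
proof -
  have "measure M {\<omega> \<in> space M. Q \<omega>} = measure (distr M M (\<theta> t)) {\<omega> \<in> space M. Q \<omega>}"
    by (simp only: flow_invariant)
  also have "\<dots> = measure M (\<theta> t -` {\<omega> \<in> space M. Q \<omega>} \<inter> space M)"
    using assms by (intro measure_distr) auto
  also have "\<theta> t -` {\<omega> \<in> space M. Q \<omega>} \<inter> space M = {\<omega> \<in> space M. Q (\<theta> t \<omega>)}"
    using measurable_space[OF measurable_flow] by auto
  finally show ?thesis by simp
qed

lemma markov_op_eq_pullback:
  assumes "0 \<le> t" and "f \<in> borel_measurable borel"
  shows "markov_op M \<phi> t f x = (\<integral>\<omega>. f (\<phi> t (\<theta> (- t) \<omega>) x) \<partial>M)"
proof -
  have "markov_op M \<phi> t f x = (\<integral>\<omega>. f (\<phi> t \<omega> x) \<partial>distr M M (\<theta> (- t)))"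
    by (simp only: markov_op_def flow_invariant)
  also have "\<dots> = (\<integral>\<omega>. f (\<phi> t (\<theta> (- t) \<omega>) x) \<partial>M)"
    using measurable_cocycle[OF assms(1)] assms(2) by (intro integral_distr) auto
  finally show ?thesis .
qed

lemma markov_op_tendsto_expectation:
  assumes a: "a \<in> borel_measurable M"
    and pull: "tendsto_in_prob M (\<lambda>t \<omega>. dist (\<phi> t (\<theta> (- t) \<omega>) x) (a \<omega>)) (\<lambda>\<omega>. 0) at_top"
    and f: "continuous_on UNIV f" "bounded (range f)"
  shows "((\<lambda>t. markov_op M \<phi> t f x) \<longlongrightarrow> (\<integral>\<omega>. f (a \<omega>) \<partial>M)) at_top"
proof -
  have "\<forall>\<^sub>F t in at_top. (\<lambda>\<omega>. \<phi> t (\<theta> (- t) \<omega>) x) \<in> borel_measurable M"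
    using eventually_ge_at_top[of 0]
    by eventually_elim (rule measurable_compose[OF measurable_flow measurable_cocycle])
  then have "((\<lambda>t. \<integral>\<omega>. f (\<phi> t (\<theta> (- t) \<omega>) x) \<partial>M) \<longlongrightarrow> (\<integral>\<omega>. f (a \<omega>) \<partial>M)) at_top"
    using a pull f by (rule tendsto_in_prob_imp_tendsto_expectation)
  moreover have "\<forall>\<^sub>F t in at_top. (\<integral>\<omega>. f (\<phi> t (\<theta> (- t) \<omega>) x) \<partial>M) = markov_op M \<phi> t f x"
    using eventually_ge_at_top[of 0]
    by eventually_elim (simp add: markov_op_eq_pullback borel_measurable_continuous_onI f(1))
  ultimately show ?thesis by (rule Lim_transform_eventually)
qed

text \<open>
  A limit of \<open>P\<^sub>t f\<close> that is the same constant at every point can only be the mean of \<open>f\<close> under the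
  invariant measure: integration against \<open>\<rho>\<close> turns the convergence into that of a constant
  sequence.
\<close>

lemma invariant_integral_eq_limit:
  assumes inv: "invariant_prob M \<phi> \<rho>"
    and f: "f \<in> borel_measurable borel" "bounded (range f)"
    and lim: "\<And>x. ((\<lambda>t. markov_op M \<phi> t f x) \<longlongrightarrow> L) at_top"
  shows "(\<integral>x. f x \<partial>\<rho>) = L"
proof -
  interpret \<rho>: prob_space \<rho> using inv by (simp add: invariant_prob_def)
  have sets_\<rho>: "sets \<rho> = sets borel" using inv by (simp add: invariant_prob_def)
  obtain C where C: "\<And>x. \<bar>f x\<bar> \<le> C"
    using f(2) unfolding bounded_pos by auto
  have meas: "markov_op M \<phi> (real n) f \<in> borel_measurable \<rho>" for n
  proof -
    have "(\<lambda>(x, \<omega>). f (\<phi> (real n) \<omega> x)) \<in> borel_measurable (borel \<Otimes>\<^sub>M M)"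
      using measurable_compose[OF measurable_pair_swap' measurable_compose[OF
          measurable_cocycle_pair[of "real n"] f(1)]]
      by (simp add: case_prod_beta')
    then have "markov_op M \<phi> (real n) f \<in> borel_measurable borel"
      unfolding markov_op_def by (rule borel_measurable_lebesgue_integral)
    then show ?thesis by (simp cong: measurable_cong_sets add: sets_\<rho>)
  qed
  have bound: "\<bar>markov_op M \<phi> (real n) f x\<bar> \<le> C" for n x
  proof -
    have "integrable M (\<lambda>\<omega>. f (\<phi> (real n) \<omega> x))"
      using measurable_compose[OF measurable_cocycle[of "real n" x] f(1)]
      by (auto intro!: integrable_const_bound[where B = C] simp: C)
    then have "(\<integral>\<omega>. \<bar>f (\<phi> (real n) \<omega> x)\<bar> \<partial>M) \<le> C"
      by (intro integral_le_const) (auto simp: C)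
    with integral_abs_bound[of M "\<lambda>\<omega>. f (\<phi> (real n) \<omega> x)"] show ?thesis
      unfolding markov_op_def by linarith
  qed
  have "(\<lambda>n. \<integral>x. markov_op M \<phi> (real n) f x \<partial>\<rho>) \<longlonglongrightarrow> (\<integral>x. L \<partial>\<rho>)"
    using meas bound filterlim_compose[OF lim filterlim_real_sequentially]
    by (intro integral_dominated_convergence[where w = "\<lambda>_. C"]) auto
  moreover have "(\<integral>x. markov_op M \<phi> (real n) f x \<partial>\<rho>) = (\<integral>x. f x \<partial>\<rho>)" for n
    using inv f by (simp add: invariant_prob_def)
  ultimately show ?thesis
    by (simp add: \<rho>.prob_space LIMSEQ_const_iff)
qed

section \<open>Convergence of distances and stability\<close>

lemma forward_distance_tendsto_zero:
  assumes a: "a \<in> borel_measurable M"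
    and pull: "\<And>x. tendsto_in_prob M (\<lambda>t \<omega>. dist (\<phi> t (\<theta> (- t) \<omega>) x) (a \<omega>)) (\<lambda>\<omega>. 0) at_top"
  shows "tendsto_in_prob M (\<lambda>t \<omega>. dist (\<phi> t \<omega> x) (\<phi> t \<omega> y)) (\<lambda>\<omega>. 0) at_top"
  unfolding tendsto_in_prob_def
proof (intro allI impI)
  fix \<epsilon> :: real assume "0 < \<epsilon>"
  define p where "p z t = prob {\<omega> \<in> space M. \<epsilon> / 2 < dist (\<phi> t (\<theta> (- t) \<omega>) z) (a \<omega>)}" for z t
  have "(p z \<longlongrightarrow> 0) at_top" for z
    using pull[of z, unfolded tendsto_in_prob_def, rule_format, of "\<epsilon> / 2"] \<open>0 < \<epsilon>\<close>
    unfolding p_def by (simp del: less_divide_eq_numeral1 divide_less_eq_numeral1)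
  then have sum: "((\<lambda>t. p x t + p y t) \<longlongrightarrow> 0) at_top"
    using tendsto_add[of "p x" 0 at_top "p y" 0] by simp
  have le: "prob {\<omega> \<in> space M. \<epsilon> < dist (dist (\<phi> t \<omega> x) (\<phi> t \<omega> y)) 0} \<le> p x t + p y t"
    if t: "0 \<le> t" for t
  proof -
    note [measurable] = a measurable_cocycle[OF t]
      measurable_compose[OF measurable_flow measurable_cocycle[OF t]]
    have "prob {\<omega> \<in> space M. \<epsilon> < dist (dist (\<phi> t \<omega> x) (\<phi> t \<omega> y)) 0}
      = prob {\<omega> \<in> space M. \<epsilon> < dist (\<phi> t \<omega> x) (\<phi> t \<omega> y)}" by simp
    also have "\<dots> = prob {\<omega> \<in> space M. \<epsilon> < dist (\<phi> t (\<theta> (- t) \<omega>) x) (\<phi> t (\<theta> (- t) \<omega>) y)}"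
      by (rule measure_flow_pullback[symmetric]) measurable
    also have "\<dots> \<le> prob ({\<omega> \<in> space M. \<epsilon> / 2 < dist (\<phi> t (\<theta> (- t) \<omega>) x) (a \<omega>)}
        \<union> {\<omega> \<in> space M. \<epsilon> / 2 < dist (\<phi> t (\<theta> (- t) \<omega>) y) (a \<omega>)})"
    proof (rule finite_measure_mono)
      have "\<epsilon> / 2 < dist u c \<or> \<epsilon> / 2 < dist v c" if "\<epsilon> < dist u v" for u v c :: 'e
        using that dist_triangle2[of u v c] by linarith
      then show "{\<omega> \<in> space M. \<epsilon> < dist (\<phi> t (\<theta> (- t) \<omega>) x) (\<phi> t (\<theta> (- t) \<omega>) y)}
        \<subseteq> {\<omega> \<in> space M. \<epsilon> / 2 < dist (\<phi> t (\<theta> (- t) \<omega>) x) (a \<omega>)}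
        \<union> {\<omega> \<in> space M. \<epsilon> / 2 < dist (\<phi> t (\<theta> (- t) \<omega>) y) (a \<omega>)}" by blast
    qed measurable
    also have "\<dots> \<le> p x t + p y t"
      unfolding p_def by (rule measure_Un_le) measurable
    finally show ?thesis .
  qed
  show "((\<lambda>t. prob {\<omega> \<in> space M. \<epsilon> < dist (dist (\<phi> t \<omega> x) (\<phi> t \<omega> y)) 0}) \<longlongrightarrow> 0) at_top"
  proof (rule tendsto_sandwich[OF _ _ tendsto_const sum])
    show "\<forall>\<^sub>F t in at_top. prob {\<omega> \<in> space M. \<epsilon> < dist (dist (\<phi> t \<omega> x) (\<phi> t \<omega> y)) 0}
        \<le> p x t + p y t"
      using eventually_ge_at_top[of 0] by eventually_elim (rule le)
  qed simp
qed

lemma weak_global_pointwise_stabilityI: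
  assumes \<rho>: "prob_space \<rho>" "sets \<rho> = sets borel"
    and conv: "\<And>x y. tendsto_in_prob M (\<lambda>t \<omega>. dist (\<phi> t \<omega> x) (\<phi> t \<omega> y)) (\<lambda>\<omega>. 0) at_top"
  shows "weak_global_pointwise_stability M \<phi> \<rho>"
proof -
  have liminf_ge: "ereal 1 \<le> liminf (\<lambda>n. ereal (prob
      {\<omega> \<in> space M. dist (\<phi> (real n) \<omega> x) (\<phi> (real n) \<omega> y) \<le> \<eta>}))"
    if "0 < \<eta>" for \<eta> x y
  proof -
    have compl: "prob {\<omega> \<in> space M. dist (\<phi> (real n) \<omega> x) (\<phi> (real n) \<omega> y) \<le> \<eta>}
      = 1 - prob {\<omega> \<in> space M. \<eta> < dist (dist (\<phi> (real n) \<omega> x) (\<phi> (real n) \<omega> y)) 0}" for n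
    proof -
      note [measurable] = measurable_cocycle[of "real n", simplified]
      have "prob {\<omega> \<in> space M. \<not> \<eta> < dist (\<phi> (real n) \<omega> x) (\<phi> (real n) \<omega> y)}
        = 1 - prob {\<omega> \<in> space M. \<eta> < dist (\<phi> (real n) \<omega> x) (\<phi> (real n) \<omega> y)}"
        by (rule prob_neg) measurable
      then show ?thesis by (simp add: not_less)
    qed
    have "((\<lambda>t. prob {\<omega> \<in> space M. \<eta> < dist (dist (\<phi> t \<omega> x) (\<phi> t \<omega> y)) 0}) \<longlongrightarrow> 0) at_top"
      using conv[of x y] that by (simp add: tendsto_in_prob_def)
    from tendsto_diff[OF tendsto_const[of 1] filterlim_compose[OF this filterlim_real_sequentially]]
    have "(\<lambda>n. ereal (prob {\<omega> \<in> space M. dist (\<phi> (real n) \<omega> x) (\<phi> (real n) \<omega> y) \<le> \<eta>}))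
        \<longlonglongrightarrow> ereal 1"
      unfolding compl by (intro tendsto_ereal) simp
    from lim_imp_Liminf[OF _ this] show ?thesis by simp
  qed
  have "measure \<rho> UNIV = 1"
    using prob_space.prob_space[OF \<rho>(1)] sets_eq_imp_space_eq[OF \<rho>(2)] by simp
  moreover have "incseq real" by (simp add: incseq_def)
  ultimately show ?thesis
    unfolding weak_global_pointwise_stability_def
    using liminf_ge zero_less_one filterlim_real_sequentially
    by (intro bexI[of _ UNIV] conjI exI[of _ real] ballI exI[of _ 1]) auto
qed

end

theorem mainTheorem2:
  fixes M :: "'w measure"
    and \<theta> :: "real \<Rightarrow> 'w \<Rightarrow> 'w"
    and F :: "real \<Rightarrow> real \<Rightarrow> 'w measure"
    and \<phi> :: "real \<Rightarrow> 'w \<Rightarrow> 'e :: polish_space \<Rightarrow> 'e"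
    and \<rho> :: "'e measure"
  assumes "white_noise_rds M \<theta> F \<phi>"
    and "ergodic_invariant_prob M \<phi> \<rho>"
    and "weak_synchronization M \<theta> F \<phi>"
  shows "strongly_mixing M \<phi> \<rho> \<and>
    (\<forall>x y. tendsto_in_prob M (\<lambda>t \<omega>. dist (\<phi> t \<omega> x) (\<phi> t \<omega> y)) (\<lambda>\<omega>. 0) at_top) \<and>
    weak_global_pointwise_stability M \<phi> \<rho>"
proof -
  interpret white_noise_rds M \<theta> F \<phi> by (rule assms(1))
  have inv: "invariant_prob M \<phi> \<rho>"
    using assms(2) by (simp add: ergodic_invariant_prob_def)
  obtain a where "a \<in> past M F 0 \<rightarrow>\<^sub>M borel"
    and pull: "\<And>x. tendsto_in_prob M (\<lambda>t \<omega>. dist (\<phi> t (\<theta> (- t) \<omega>) x) (a \<omega>)) (\<lambda>\<omega>. 0) at_top"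
    using assms(3) unfolding weak_synchronization_def by blast
  then have a: "a \<in> borel_measurable M" by (intro measurable_past_imp_measurable)
  have "((\<lambda>t. markov_op M \<phi> t f x) \<longlongrightarrow> (\<integral>y. f y \<partial>\<rho>)) at_top"
    if f: "continuous_on UNIV f" "bounded (range f)" for f x
  proof -
    note lim = markov_op_tendsto_expectation[OF a pull f]
    have "(\<integral>y. f y \<partial>\<rho>) = (\<integral>\<omega>. f (a \<omega>) \<partial>M)"
      using inv borel_measurable_continuous_onI[OF f(1)] f(2) lim
      by (rule invariant_integral_eq_limit)
    with lim show ?thesis by simp
  qed
  then have "strongly_mixing M \<phi> \<rho>" by (simp add: strongly_mixing_def)
  moreover note conv = forward_distance_tendsto_zero[OF a pull]
  moreover have "weak_global_pointwise_stability M \<phi> \<rho>"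
    using inv conv by (intro weak_global_pointwise_stabilityI) (auto simp: invariant_prob_def)
  ultimately show ?thesis by blast
qed

end
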